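(* Let $\mathcal{A}$ be a Boolean tensor of size $I_1\times\cdots\times I_M\times J_1\times\cdots\times J_N$. Then the following statements are equivalent: (i) The Moore-Penrose inverse of $\mathcal{A}$ exists and is unique. (ii) $\mathcal{A}*_N\mathcal{A}^T*_M\mathcal{A}\leq\mathcal{A}$. (iii) $\mathcal{A}*_N\mathcal{A}^T*_M\mathcal{A}=\mathcal{A}$. (iv) The Moore-Penrose inverse of $\mathcal{A}$ exists and equals $\mathcal{A}^T$. (v) There exists a Boolean tensor $\mathcal{G}$ of size $J_1\times\cdots\times J_N\times I_1\times\cdots\times I_M$ such that $\mathcal{G}*_M\mathcal{A}*_N\mathcal{A}^T=\mathcal{A}^T$ and $\mathcal{A}^T*_M\mathcal{A}*_N\mathcal{G}=\mathcal{A}^T$.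
   Context: A Boolean tensor is an array with entries in $\{0,1\}$; entries are added and multiplied by the rules of the binary Boolean algebra ($1+1=1$, otherwise as usual). For $\mathcal{A}$ of size $I_1\times\cdots\times I_M\times J_1\times\cdots\times J_N$ and $\mathcal{B}$ of size $J_1\times\cdots\times J_N\times K_1\times\cdots\times K_L$, the Einstein product $\mathcal{A}*_N\mathcal{B}$ has entries $\sum_{j_1,\dots,j_N}a_{i_1\ldots i_Mj_1\ldots j_N}b_{j_1\ldots j_Nk_1\ldots k_L}$ (Boolean sum); the subscript of $*$ is the number of contracted indices. The transpose $\mathcal{A}^T$, of size $J_1\times\cdots\times J_N\times I_1\times\cdots\times I_M$, has entries $(\mathcal{A}^T)_{j_1\ldots j_Ni_1\ldots i_M}=a_{i_1\ldots i_Mj_1\ldots j_N}$. $\mathcal{A}\le\mathcal{B}$ means entrywise inequality. A Moore-Penrose inverse of $\mathcal{A}$ is a Boolean tensor $\mathcal{X}$ of size $J_1\times\cdots\times J_N\times I_1\times\cdots\times I_M$ with (1) $\mathcal{A}*_N\mathcal{X}*_M\mathcal{A}=\mathcal{A}$, (2) $\mathcal{X}*_M\mathcal{A}*_N\mathcal{X}=\mathcal{X}$, (3) $(\mathcal{A}*_N\mathcal{X})^T=\mathcal{A}*_N\mathcal{X}$, (4) $(\mathcal{X}*_M\mathcal{A})^T=\mathcal{X}*_M\mathcal{A}$. *)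

theory Defs
  imports Main "HOL-Library.FuncSet"
begin

(* Multi-indices are lists, with 0-based components. *)
definition multi_indices :: "nat list \<Rightarrow> nat list set" where
  "multi_indices ds = {ix. list_all2 (<) ix ds}"

(* A tensor carries its size, and has entries in the two-element Boolean algebra bool:
   False is 0, True is 1, Boolean sum is disjunction and product is conjunction.
   The entry function is normalised outside the index set, so that equality of tensors
   is equality of sizes and of entries. *)
typedef btensor =
  "{(ds, f). f \<in> extensional (multi_indices ds)} :: (nat list \<times> (nat list \<Rightarrow> bool)) set"
  by (rule exI[of _ "([], restrict (\<lambda>_. False) (multi_indices []))"]) simp

setup_lifting type_definition_btensor

lift_definition dims :: "btensor \<Rightarrow> nat list" is fst .

lift_definition entry :: "btensor \<Rightarrow> nat list \<Rightarrow> bool" is snd .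

lift_definition mk_tensor :: "nat list \<Rightarrow> (nat list \<Rightarrow> bool) \<Rightarrow> btensor"
  is "\<lambda>ds f. (ds, restrict f (multi_indices ds))"
  by simp

lemma dims_mk_tensor [simp]: "dims (mk_tensor ds f) = ds"
  by transfer simp

lemma entry_mk_tensor [simp]:
  "ix \<in> multi_indices ds \<Longrightarrow> entry (mk_tensor ds f) ix = f ix"
  by transfer simp

lemma btensor_eqI:
  assumes "dims A = dims B"
    and "\<And>ix. ix \<in> multi_indices (dims A) \<Longrightarrow> entry A ix = entry B ix"
  shows "A = B"
  using assms by transfer (auto intro: extensionalityI)

instantiation btensor :: order
begin

definition less_eq_btensor :: "btensor \<Rightarrow> btensor \<Rightarrow> bool" where
  "A \<le> B \<longleftrightarrow> dims A = dims B \<and> (\<forall>ix\<in>multi_indices (dims A). entry A ix \<le> entry B ix)"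

definition less_btensor :: "btensor \<Rightarrow> btensor \<Rightarrow> bool" where
  "A < B \<longleftrightarrow> A \<le> B \<and> \<not> B \<le> (A :: btensor)"

instance
  by standard (auto simp: less_eq_btensor_def less_btensor_def intro!: btensor_eqI)

end

(* Contracts the last n indices of A with the first n indices of B. Only meaningful if
   the contracted sizes agree. *)
definition einstein_prod :: "btensor \<Rightarrow> nat \<Rightarrow> btensor \<Rightarrow> btensor"
    ("(_ *\<^bsub>_\<^esub> _)" [70, 0, 71] 70) where
  "A *\<^bsub>n\<^esub> B =
    (let m = length (dims A) - n
     in mk_tensor (take m (dims A) @ drop n (dims B))
          (\<lambda>ix. \<exists>js\<in>multi_indices (take n (dims B)).
             entry A (take m ix @ js) \<and> entry B (js @ drop m ix)))"

(* The transpose depends on how the indices are split into two groups: the first group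
   consists of the first m indices. *)
definition tensor_transpose :: "nat \<Rightarrow> btensor \<Rightarrow> btensor" where
  "tensor_transpose m A =
    (let n = length (dims A) - m
     in mk_tensor (drop m (dims A) @ take m (dims A))
          (\<lambda>ix. entry A (drop n ix @ take n ix)))"

(* X is a Moore-Penrose inverse of A, where A has size Is @ Js. *)
definition is_moore_penrose :: "nat list \<Rightarrow> nat list \<Rightarrow> btensor \<Rightarrow> btensor \<Rightarrow> bool" where
  "is_moore_penrose Is Js A X \<longleftrightarrow>
    (let M = length Is; N = length Js in
      dims X = Js @ Is \<and>
      A *\<^bsub>N\<^esub> X *\<^bsub>M\<^esub> A = A \<and>
      X *\<^bsub>M\<^esub> A *\<^bsub>N\<^esub> X = X \<and>
      tensor_transpose M (A *\<^bsub>N\<^esub> X) = A *\<^bsub>N\<^esub> X \<and>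
      tensor_transpose N (X *\<^bsub>M\<^esub> A) = X *\<^bsub>M\<^esub> A)"

end

theory Submission imports Defs begin

text \<open>
  Splitting the indices of a tensor into two groups makes it a binary relation between
  multi-indices: the Einstein product becomes relational composition, the transpose becomes
  the converse, and the entrywise order becomes inclusion. The theorem is therefore a
  statement about relations, and rests on one fact that has no analogue over a field: a
  Moore-Penrose inverse of a relation \<open>R\<close> can only be \<open>R\<inverse>\<close>. The reason is
  that every relation satisfies \<open>R \<subseteq> R O R\<inverse> O R\<close>; applied to an inverse \<open>X\<close>, this
  inclusion and the Penrose equations give \<open>R\<inverse> \<subseteq> X\<close>, and since \<open>R\<close> is in turn an inverse
  of \<open>X\<close>, also \<open>X\<inverse> \<subseteq> R\<close>.

  Hence \<open>X\<close> is a Moore-Penrose inverse of \<open>R\<close> precisely if \<open>X = R\<inverse>\<close> and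
  \<open>R O R\<inverse> O R = R\<close> (\<open>rel_moore_penrose_iff\<close>), and existence, uniqueness and being the
  transpose all amount to the last equation. Its inclusion from right to left always
  holds, so only the other one is a condition. Finally, a solution \<open>G\<close> of
  \<open>G O R O R\<inverse> = R\<inverse>\<close> and \<open>R\<inverse> O R O G = R\<inverse>\<close> satisfies all Penrose equations except perhaps \<open>G O R O G = G\<close>, and passing
  to \<open>G O R O G\<close> repairs that.
\<close>

section \<open>Moore-Penrose inverses of relations\<close>

definition rel_moore_penrose :: "('a \<times> 'b) set \<Rightarrow> ('b \<times> 'a) set \<Rightarrow> bool" where
  "rel_moore_penrose R X \<longleftrightarrow>
     R O X O R = R \<and> X O R O X = X \<and> (R O X)\<inverse> = R O X \<and> (X O R)\<inverse> = X O R"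

lemma rel_moore_penrose_sym: "rel_moore_penrose R X \<Longrightarrow> rel_moore_penrose X R"
  by (simp add: rel_moore_penrose_def)

lemma rel_subset_triple: "R \<subseteq> R O R\<inverse> O R"
  by auto

text \<open>
  The symmetry of \<open>X O R\<close> and \<open>R O X\<close> turns the Penrose equations into rules that absorb
  these products next to \<open>R\<inverse>\<close> or \<open>X\<inverse>\<close>. Enlarging \<open>X\<close> to \<open>X O X\<inverse> O X\<close> inside
  \<open>R\<inverse> O R = X O R O R\<inverse> O R\<close> creates a factor \<open>X\<inverse>\<close>, against which everything else cancels.
\<close>

lemma converse_subset_moore_penrose:
  assumes "rel_moore_penrose R X"
  shows "R\<inverse> \<subseteq> X"
proof -
  have RXR: "R O X O R = R" and XRX: "X O R O X = X"
    and symL: "(R O X)\<inverse> = R O X" and symR: "(X O R)\<inverse> = X O R"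
    using assms by (auto simp: rel_moore_penrose_def)
  have absorbL: "X O R O R\<inverse> = R\<inverse>"
  proof -
    have "X O R O R\<inverse> = (X O R)\<inverse> O R\<inverse>" by (simp only: symR O_assoc)
    also have "\<dots> = (R O X O R)\<inverse>" by (simp only: converse_relcomp O_assoc)
    finally show ?thesis by (simp only: RXR)
  qed
  have absorbR: "R\<inverse> O R O X = R\<inverse>"
  proof -
    have "R\<inverse> O R O X = R\<inverse> O (R O X)\<inverse>" by (simp only: symL)
    also have "\<dots> = (R O X O R)\<inverse>" by (simp only: converse_relcomp O_assoc)
    finally show ?thesis by (simp only: RXR)
  qed
  have absorbX: "X\<inverse> O X O R = X\<inverse>"
  proof -
    have "X\<inverse> O X O R = X\<inverse> O (X O R)\<inverse>" by (simp only: symR)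
    also have "\<dots> = (X O R O X)\<inverse>" by (simp only: converse_relcomp O_assoc)
    finally show ?thesis by (simp only: XRX)
  qed
  have "R\<inverse> O R = X O (R O R\<inverse> O R)"
    using absorbL by (simp only: O_assoc[symmetric])
  also have "\<dots> \<subseteq> (X O X\<inverse> O X) O (R O R\<inverse> O R)"
    by (rule relcomp_mono[OF rel_subset_triple subset_refl])
  also have "\<dots> = X O (X\<inverse> O X O R) O R\<inverse> O R"
    by (simp only: O_assoc)
  also have "\<dots> = X O (R O X)\<inverse> O R"
    by (simp only: absorbX converse_relcomp O_assoc)
  also have "\<dots> = (X O R O X) O R"
    by (simp only: symL O_assoc)
  finally have *: "R\<inverse> O R \<subseteq> X O R"
    by (simp only: XRX)
  have "R\<inverse> = (R\<inverse> O R) O X"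
    using absorbR by (simp only: O_assoc)
  also have "\<dots> \<subseteq> (X O R) O X"
    by (rule relcomp_mono[OF * subset_refl])
  finally show ?thesis
    using XRX by (simp only: O_assoc)
qed

theorem rel_moore_penrose_iff:
  "rel_moore_penrose R X \<longleftrightarrow> X = R\<inverse> \<and> R O R\<inverse> O R = R"
proof
  assume mp: "rel_moore_penrose R X"
  have "X\<inverse> \<subseteq> R"
    by (rule converse_subset_moore_penrose[OF rel_moore_penrose_sym[OF mp]])
  with converse_subset_moore_penrose[OF mp] have "X = R\<inverse>"
    by auto
  with mp show "X = R\<inverse> \<and> R O R\<inverse> O R = R"
    by (simp add: rel_moore_penrose_def)
next
  assume *: "X = R\<inverse> \<and> R O R\<inverse> O R = R"
  then have "(R O R\<inverse> O R)\<inverse> = R\<inverse>" by simp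
  then have "R\<inverse> O R O R\<inverse> = R\<inverse>" by (simp only: converse_relcomp converse_converse O_assoc)
  with * show "rel_moore_penrose R X"
    by (simp add: rel_moore_penrose_def converse_relcomp)
qed

text \<open>
  Multiplying the transposed second equation by \<open>G\<close> shows that \<open>R O G = (R O G)\<inverse> O (R O G)\<close>,
  which is symmetric; the first equation does the same for \<open>G O R\<close>. So \<open>G\<close> is an inner
  inverse with both symmetry properties, and these pass to \<open>G O R O G\<close>.
\<close>

lemma rel_moore_penrose_of_one_sided_equations:
  fixes R :: "('a \<times> 'b) set"
  assumes left: "G O R O R\<inverse> = R\<inverse>" and right: "R\<inverse> O R O G = R\<inverse>"
  shows "rel_moore_penrose R (G O R O G)"
proof -
  have left': "R O R\<inverse> O G\<inverse> = R"
    using arg_cong[OF left, of converse] by (simp only: converse_relcomp converse_converse O_assoc)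
  have right': "G\<inverse> O R\<inverse> O R = R"
    using arg_cong[OF right, of converse] by (simp only: converse_relcomp converse_converse O_assoc)
  have symL: "(R O G)\<inverse> = R O G"
  proof -
    have "(R O G)\<inverse> = G\<inverse> O R\<inverse> O R O G"
      by (simp only: right converse_relcomp)
    also have "\<dots> = (G\<inverse> O R\<inverse> O R) O G"
      by (simp only: O_assoc)
    finally show ?thesis by (simp only: right')
  qed
  have symR: "(G O R)\<inverse> = G O R"
  proof -
    have "(G O R)\<inverse> = (G O R O R\<inverse>) O G\<inverse>"
      by (simp only: left converse_relcomp)
    also have "\<dots> = G O R O R\<inverse> O G\<inverse>"
      by (simp only: O_assoc)
    finally show ?thesis by (simp only: left')
  qed
  have "R O G O R = (R O G)\<inverse> O R"
    by (simp only: symL O_assoc)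
  then have inner: "R O G O R = R"
    using right' by (simp only: converse_relcomp O_assoc)
  have inner': "R O G O R O S = R O S" for S :: "('b \<times> 'c) set"
    using arg_cong[OF inner, of "\<lambda>T. T O S"] by (simp only: O_assoc)
  show ?thesis
    unfolding rel_moore_penrose_def O_assoc inner' inner symL symR by simp
qed

section \<open>Tensors as relations between multi-indices\<close>

lemma multi_indices_append:
  "ix \<in> multi_indices (Is @ Js) \<longleftrightarrow>
     (\<exists>is js. ix = is @ js \<and> is \<in> multi_indices Is \<and> js \<in> multi_indices Js)"
  by (auto simp: multi_indices_def list_all2_append2 dest: list_all2_lengthD)

lemma multi_indices_appendI:
  "is \<in> multi_indices Is \<Longrightarrow> js \<in> multi_indices Js \<Longrightarrow> is @ js \<in> multi_indices (Is @ Js)"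
  by (auto simp: multi_indices_append)

lemma length_multi_indices: "ix \<in> multi_indices ds \<Longrightarrow> length ix = length ds"
  by (simp add: multi_indices_def list_all2_lengthD)

definition tensor_rel ::
    "nat list \<Rightarrow> nat list \<Rightarrow> btensor \<Rightarrow> (nat list \<times> nat list) set" where
  "tensor_rel Is Js A =
     {(is, js). is \<in> multi_indices Is \<and> js \<in> multi_indices Js \<and> entry A (is @ js)}"

lemma tensor_le_iff_rel_subset:
  assumes "dims A = Is @ Js" "dims B = Is @ Js"
  shows "A \<le> B \<longleftrightarrow> tensor_rel Is Js A \<subseteq> tensor_rel Is Js B"
  using assms
  by (fastforce simp: less_eq_btensor_def tensor_rel_def multi_indices_append)

lemma tensor_eq_iff_rel_eq:
  assumes "dims A = Is @ Js" "dims B = Is @ Js"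
  shows "A = B \<longleftrightarrow> tensor_rel Is Js A = tensor_rel Is Js B"
  by (metis assms order.eq_iff tensor_le_iff_rel_subset)

lemma dims_einstein_prod:
  assumes "dims A = Is @ Js" "dims B = Js @ Ks"
  shows "dims (A *\<^bsub>length Js\<^esub> B) = Is @ Ks"
  using assms by (simp add: einstein_prod_def Let_def)

lemma tensor_rel_einstein_prod:
  assumes "dims A = Is @ Js" "dims B = Js @ Ks"
  shows "tensor_rel Is Ks (A *\<^bsub>length Js\<^esub> B) = tensor_rel Is Js A O tensor_rel Js Ks B"
  using assms
  by (auto simp: einstein_prod_def Let_def tensor_rel_def relcomp_unfold
      multi_indices_appendI length_multi_indices)

lemma dims_tensor_transpose:
  assumes "dims A = Is @ Js"
  shows "dims (tensor_transpose (length Is) A) = Js @ Is"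
  using assms by (simp add: tensor_transpose_def Let_def)

lemma tensor_rel_transpose:
  assumes "dims A = Is @ Js"
  shows "tensor_rel Js Is (tensor_transpose (length Is) A) = (tensor_rel Is Js A)\<inverse>"
  using assms
  by (auto simp: tensor_transpose_def Let_def tensor_rel_def
      multi_indices_appendI length_multi_indices)

lemma dims_einstein_prod_triple:
  assumes "dims A = Is @ Js" "dims B = Js @ Ks" "dims C = Ks @ Ls"
  shows "dims (A *\<^bsub>length Js\<^esub> B *\<^bsub>length Ks\<^esub> C) = Is @ Ls"
  using assms by (blast intro: dims_einstein_prod)

lemma tensor_rel_einstein_prod_triple:
  assumes "dims A = Is @ Js" "dims B = Js @ Ks" "dims C = Ks @ Ls"
  shows "tensor_rel Is Ls (A *\<^bsub>length Js\<^esub> B *\<^bsub>length Ks\<^esub> C) =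
           tensor_rel Is Js A O tensor_rel Js Ks B O tensor_rel Ks Ls C"
  using assms
  by (simp add: tensor_rel_einstein_prod[OF dims_einstein_prod] tensor_rel_einstein_prod O_assoc)

lemma is_moore_penrose_iff_rel:
  assumes A: "dims A = Is @ Js"
  shows "is_moore_penrose Is Js A X \<longleftrightarrow>
    dims X = Js @ Is \<and> rel_moore_penrose (tensor_rel Is Js A) (tensor_rel Js Is X)"
proof (cases "dims X = Js @ Is")
  case X: True
  have AX: "dims (A *\<^bsub>length Js\<^esub> X) = Is @ Is" and XA: "dims (X *\<^bsub>length Is\<^esub> A) = Js @ Js"
    by (rule dims_einstein_prod[OF A X], rule dims_einstein_prod[OF X A])
  show ?thesis
    unfolding is_moore_penrose_def Let_def rel_moore_penrose_def
    by (simp only: X simp_thms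
        tensor_eq_iff_rel_eq[OF dims_einstein_prod_triple[OF A X A] A]
        tensor_eq_iff_rel_eq[OF dims_einstein_prod_triple[OF X A X] X]
        tensor_eq_iff_rel_eq[OF dims_tensor_transpose[OF AX] AX]
        tensor_eq_iff_rel_eq[OF dims_tensor_transpose[OF XA] XA]
        tensor_rel_einstein_prod_triple[OF A X A] tensor_rel_einstein_prod_triple[OF X A X]
        tensor_rel_transpose[OF AX] tensor_rel_transpose[OF XA]
        tensor_rel_einstein_prod[OF A X] tensor_rel_einstein_prod[OF X A])
next
  case False
  then show ?thesis
    by (simp add: is_moore_penrose_def Let_def)
qed

section \<open>The equivalent conditions\<close>

theorem theorem3p27:
  fixes A :: btensor and Is Js :: "nat list" and M N :: nat
  assumes "length Is = M" and "length Js = N"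
    and "dims A = Is @ Js"
  defines "AT \<equiv> tensor_transpose M A"
  shows
    "((\<exists>!X. is_moore_penrose Is Js A X) \<longleftrightarrow> A *\<^bsub>N\<^esub> AT *\<^bsub>M\<^esub> A \<le> A) \<and>
     (A *\<^bsub>N\<^esub> AT *\<^bsub>M\<^esub> A \<le> A \<longleftrightarrow> A *\<^bsub>N\<^esub> AT *\<^bsub>M\<^esub> A = A) \<and>
     (A *\<^bsub>N\<^esub> AT *\<^bsub>M\<^esub> A = A \<longleftrightarrow>
       (\<exists>X. is_moore_penrose Is Js A X) \<and> (\<forall>X. is_moore_penrose Is Js A X \<longrightarrow> X = AT)) \<and>
     ((\<exists>X. is_moore_penrose Is Js A X) \<and> (\<forall>X. is_moore_penrose Is Js A X \<longrightarrow> X = AT) \<longleftrightarrow>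
       (\<exists>G. dims G = Js @ Is \<and> G *\<^bsub>M\<^esub> A *\<^bsub>N\<^esub> AT = AT \<and> AT *\<^bsub>M\<^esub> A *\<^bsub>N\<^esub> G = AT))"
proof -
  note A = \<open>dims A = Is @ Js\<close>
  let ?R = "tensor_rel Is Js A"
  let ?iii = "?R O ?R\<inverse> O ?R = ?R"
  have AT: "dims AT = Js @ Is" and rel_AT: "tensor_rel Js Is AT = ?R\<inverse>"
    using A \<open>length Is = M\<close> by (auto simp: AT_def dims_tensor_transpose tensor_rel_transpose)
  note prods = dims_einstein_prod_triple tensor_rel_einstein_prod_triple
  have mp_iff: "is_moore_penrose Is Js A X \<longleftrightarrow> X = AT \<and> ?iii" for X
  proof (cases "dims X = Js @ Is")
    case True
    show ?thesis
      by (simp only: is_moore_penrose_iff_rel[OF A] rel_moore_penrose_iff True simp_thms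
          tensor_eq_iff_rel_eq[OF True AT] rel_AT)
  next
    case False
    then show ?thesis
      using AT by (auto simp: is_moore_penrose_iff_rel[OF A])
  qed
  have AATA: "dims (A *\<^bsub>N\<^esub> AT *\<^bsub>M\<^esub> A) = Is @ Js"
    "tensor_rel Is Js (A *\<^bsub>N\<^esub> AT *\<^bsub>M\<^esub> A) = ?R O ?R\<inverse> O ?R"
    using prods[OF A AT A] assms(1,2) rel_AT by auto
  have ii: "A *\<^bsub>N\<^esub> AT *\<^bsub>M\<^esub> A \<le> A \<longleftrightarrow> ?iii"
    using rel_subset_triple[of ?R]
    by (auto simp only: tensor_le_iff_rel_subset[OF AATA(1) A] AATA(2))
  have iii: "A *\<^bsub>N\<^esub> AT *\<^bsub>M\<^esub> A = A \<longleftrightarrow> ?iii"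
    by (simp only: tensor_eq_iff_rel_eq[OF AATA(1) A] AATA(2))
  have v: "(\<exists>G. dims G = Js @ Is \<and> G *\<^bsub>M\<^esub> A *\<^bsub>N\<^esub> AT = AT \<and> AT *\<^bsub>M\<^esub> A *\<^bsub>N\<^esub> G = AT) \<longleftrightarrow> ?iii"
    (is "(\<exists>G. ?v G) \<longleftrightarrow> _")
  proof
    assume "\<exists>G. ?v G"
    then obtain G where G: "dims G = Js @ Is"
      and eqs: "G *\<^bsub>M\<^esub> A *\<^bsub>N\<^esub> AT = AT" "AT *\<^bsub>M\<^esub> A *\<^bsub>N\<^esub> G = AT"
      by blast
    let ?G = "tensor_rel Js Is G"
    have "?G O ?R O ?R\<inverse> = ?R\<inverse>"
      using prods(2)[OF G A AT] eqs(1) rel_AT assms(1,2) by simp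
    moreover have "?R\<inverse> O ?R O ?G = ?R\<inverse>"
      using prods(2)[OF AT A G] eqs(2) rel_AT assms(1,2) by simp
    ultimately have "rel_moore_penrose ?R (?G O ?R O ?G)"
      by (rule rel_moore_penrose_of_one_sided_equations)
    then show ?iii
      by (simp only: rel_moore_penrose_iff)
  next
    assume ?iii
    then have "is_moore_penrose Is Js A AT"
      by (simp add: mp_iff)
    then have "?v AT"
      using assms(1,2) by (simp add: is_moore_penrose_def Let_def)
    then show "\<exists>G. ?v G" ..
  qed
  show ?thesis
    unfolding ii iii v mp_iff by auto
qed

end
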